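(* For any graph $G$ we have $$\frac{\operatorname{mad}(G)}{4} \leq \operatorname{qn}_\ell(G) \leq \frac{\operatorname{mad}(G)}{2}+2,$$ where $\operatorname{mad}(G)$ is the maximum average degree of $G$ and $\operatorname{qn}_\ell(G)$ is the local queue number of $G$.
   Context: Graphs are finite, simple, undirected and nonempty. The maximum average degree is $\operatorname{mad}(G)=\max\{2|E(H)|/|V(H)| : H\subseteq G,\ H\neq\emptyset\}$, the maximum being over subgraphs $H$ with at least one vertex. Given a linear ordering $\prec$ of the vertex set of a graph, two edges $uv$ and $xy$ nest if $u \prec x \prec y \prec v$ or $x \prec u \prec v \prec y$ (for the endpoints named suitably). A queue is a set of edges no two of which nest. A queue layout of $G$ consists of a linear ordering $\prec$ of $V(G)$ and a partition of $E(G)$ into queues; it is $\ell$-local if every vertex has incident edges in at most $\ell$ queues (the total number of queues being arbitrary). The local queue number $\operatorname{qn}_\ell(G)$ (the subscript is part of the name, not a parameter) is the smallest integer $\ell$ such that $G$ has an $\ell$-local queue layout. *)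

theory Defs
  imports Complex_Main "HOL-Library.Disjoint_Sets"
begin

text \<open>A graph is given by its vertex set and its set of edges, an edge being the two-element
  set of its endpoints.\<close>

definition simple_graph :: "'a set \<Rightarrow> 'a set set \<Rightarrow> bool" where
  "simple_graph V E \<longleftrightarrow> finite V \<and> V \<noteq> {} \<and> (\<forall>e\<in>E. e \<subseteq> V \<and> card e = 2)"

definition subgraph :: "'a set \<Rightarrow> 'a set set \<Rightarrow> 'a set \<Rightarrow> 'a set set \<Rightarrow> bool" where
  "subgraph W F V E \<longleftrightarrow> simple_graph W F \<and> W \<subseteq> V \<and> F \<subseteq> E"

definition mad :: "'a set \<Rightarrow> 'a set set \<Rightarrow> real" where
  "mad V E = Max {2 * real (card F) / real (card W) | W F. subgraph W F V E}"

text \<open>Orderings are reflexive relations in the sense of \<^const>\<open>linear_order_on\<close>; this is the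
  associated strict ordering.\<close>

definition precedes :: "('a \<times> 'a) set \<Rightarrow> 'a \<Rightarrow> 'a \<Rightarrow> bool" where
  "precedes r u v \<longleftrightarrow> (u, v) \<in> r \<and> u \<noteq> v"

definition nests :: "('a \<times> 'a) set \<Rightarrow> 'a set \<Rightarrow> 'a set \<Rightarrow> bool" where
  "nests r e f \<longleftrightarrow> (\<exists>u v x y. e = {u, v} \<and> f = {x, y} \<and>
     (precedes r u x \<and> precedes r x y \<and> precedes r y v \<or>
      precedes r x u \<and> precedes r u v \<and> precedes r v y))"

definition is_queue :: "('a \<times> 'a) set \<Rightarrow> 'a set set \<Rightarrow> bool" where
  "is_queue r Q \<longleftrightarrow> (\<forall>e\<in>Q. \<forall>f\<in>Q. \<not> nests r e f)"

definition queue_layout ::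
  "'a set \<Rightarrow> 'a set set \<Rightarrow> ('a \<times> 'a) set \<Rightarrow> 'a set set set \<Rightarrow> bool" where
  "queue_layout V E r P \<longleftrightarrow>
     linear_order_on V r \<and> partition_on E P \<and> (\<forall>Q\<in>P. is_queue r Q)"

definition local_layout :: "nat \<Rightarrow> 'a set \<Rightarrow> 'a set set set \<Rightarrow> bool" where
  "local_layout l V P \<longleftrightarrow> (\<forall>v\<in>V. card {Q \<in> P. \<exists>e\<in>Q. v \<in> e} \<le> l)"

definition local_queue_number :: "'a set \<Rightarrow> 'a set set \<Rightarrow> nat" where
  "local_queue_number V E = (LEAST l. \<exists>r P. queue_layout V E r P \<and> local_layout l V P)"

end

theory Submission
  imports Defs
begin

text \<open>Lower bound: ranking the vertices of a queue along the ordering, two distinct edges with the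
  same sum of endpoint ranks would nest, so a queue on \<open>n\<close> vertices has fewer than \<open>2n\<close> edges;
  summing over the queues counts every vertex at most \<open>\<ell>\<close> times.

  Upper bound: for \<open>k = \<lceil>mad(G)/2\<rceil>\<close> a Hall-type argument orients \<open>G\<close> with all out-degrees at most
  \<open>k\<close>. Edges with a common endpoint never nest, so for an arbitrary vertex ordering the edges
  directed towards a fixed vertex form a queue, and a vertex meets only its own in-star and those
  of its at most \<open>k\<close> out-neighbours.\<close>

section \<open>Basic bounds on the maximum average degree\<close>

lemma simple_graph_finite_edges:
  assumes "simple_graph V E"
  shows "finite E"
  using assms unfolding simple_graph_def by (meson Pow_iff finite_Pow_iff finite_subset subsetI)

lemma finite_densities:
  assumes "simple_graph V E"
  shows "finite {2 * real (card F) / real (card W) | W F. subgraph W F V E}"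
proof (rule finite_subset)
  show "{2 * real (card F) / real (card W) | W F. subgraph W F V E}
    \<subseteq> (\<lambda>(W, F). 2 * real (card F) / real (card W)) ` (Pow V \<times> Pow E)"
    unfolding subgraph_def by auto
  show "finite ((\<lambda>(W, F). 2 * real (card F) / real (card W)) ` (Pow V \<times> Pow E))"
    using assms simple_graph_finite_edges[OF assms] by (simp add: simple_graph_def)
qed

lemma density_le_mad:
  assumes "simple_graph V E" "subgraph W F V E"
  shows "2 * real (card F) / real (card W) \<le> mad V E"
  unfolding mad_def using finite_densities[OF assms(1)] assms(2) by (intro Max_ge) auto

lemma mad_le:
  assumes "simple_graph V E"
    and "\<And>W F. subgraph W F V E \<Longrightarrow> 2 * real (card F) / real (card W) \<le> c"
  shows "mad V E \<le> c"
proof -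
  \<comment> \<open>The graph itself is a candidate, so \<open>Max\<close> ranges over a nonempty
    set.\<close>
  have "subgraph V E V E"
    using assms(1) by (simp add: subgraph_def)
  then show ?thesis
    unfolding mad_def using finite_densities[OF assms(1)] assms(2) by (subst Max_le_iff) auto
qed

lemma mad_nonneg:
  assumes "simple_graph V E"
  shows "0 \<le> mad V E"
  using density_le_mad[of V E V "{}"] assms by (simp add: subgraph_def simple_graph_def)

section \<open>Capacitated Hall theorem\<close>

text \<open>Rado's submodularity argument: if neither \<open>x\<close> nor \<open>y\<close> could be discarded, the union and the
  intersection of the two violating families would contradict Hall's condition.\<close>

lemma hall_discard:
  fixes A :: "'e \<Rightarrow> 'v set" and k :: nat
  assumes "finite E" and fin: "\<And>e. e \<in> E \<Longrightarrow> finite (A e)"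
    and hall: "\<And>I. I \<subseteq> E \<Longrightarrow> card I \<le> k * card (\<Union>(A ` I))"
    and e: "e \<in> E" and xy: "x \<in> A e" "y \<in> A e" "x \<noteq> y"
  obtains z where "z \<in> A e"
    "\<And>I. I \<subseteq> E \<Longrightarrow> card I \<le> k * card (\<Union>((A(e := A e - {z})) ` I))"
proof -
  \<comment> \<open>A family violating the condition after discarding \<open>z\<close> must contain
    \<open>e\<close>, since otherwise its neighbourhood is unchanged. Removing \<open>e\<close> from
    it lowers the cardinality by one and turns the strict violation into a weak inequality.\<close>
  have bad: "\<exists>I. I \<subseteq> E - {e} \<and> k * card (\<Union>(A ` I) \<union> (A e - {z})) \<le> card I"
    if "I \<subseteq> E" "\<not> card I \<le> k * card (\<Union>((A(e := A e - {z})) ` I))" for z I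
  proof -
    have "e \<in> I"
    proof (rule ccontr)
      assume "e \<notin> I"
      then have "(A(e := A e - {z})) ` I = A ` I"
        by (auto simp: image_iff)
      then show False
        using that hall by simp
    qed
    then have "\<Union>((A(e := A e - {z})) ` I) = \<Union>(A ` (I - {e})) \<union> (A e - {z})"
      by (auto split: if_splits)
    moreover have "card I = Suc (card (I - {e}))"
      using \<open>e \<in> I\<close> \<open>I \<subseteq> E\<close> \<open>finite E\<close> by (metis card_Suc_Diff1 finite_subset)
    ultimately show ?thesis
      using that by (intro exI[of _ "I - {e}"]) auto
  qed
  note discard = that
  show ?thesis
  proof (rule ccontr)
    assume "\<not> thesis"
    then have "\<exists>I. I \<subseteq> E \<and> \<not> card I \<le> k * card (\<Union>((A(e := A e - {z})) ` I))" if "z \<in> A e" for z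
      using discard that by blast
    then obtain I J where
      I: "I \<subseteq> E - {e}" "k * card (\<Union>(A ` I) \<union> (A e - {x})) \<le> card I" and
      J: "J \<subseteq> E - {e}" "k * card (\<Union>(A ` J) \<union> (A e - {y})) \<le> card J"
      using bad xy by meson
    let ?X = "\<Union>(A ` I) \<union> (A e - {x})" and ?Y = "\<Union>(A ` J) \<union> (A e - {y})"
    have finIJ: "finite I" "finite J"
      using I(1) J(1) \<open>finite E\<close> by (auto intro: finite_subset)
    have finXY: "finite ?X" "finite ?Y"
      using finIJ fin I(1) J(1) e by auto
    \<comment> \<open>The extra one is \<open>e\<close>, which lies in neither \<open>I\<close> nor
      \<open>J\<close> and is added to their union; it produces the contradiction.\<close>
    have "Suc (card I + card J) = Suc (card (I \<union> J)) + card (I \<inter> J)"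
      using card_Un_Int[OF finIJ] by simp
    also have "Suc (card (I \<union> J)) = card (insert e (I \<union> J))"
      using I(1) J(1) finIJ by (intro card_insert_disjoint[symmetric]) auto
    also have "card (insert e (I \<union> J)) + card (I \<inter> J)
        \<le> k * (card (\<Union>(A ` insert e (I \<union> J))) + card (\<Union>(A ` (I \<inter> J))))"
      unfolding distrib_left using I(1) J(1) e by (intro add_mono hall) auto
    \<comment> \<open>As \<open>x\<close> and \<open>y\<close> differ, the two punctured copies of
      \<open>A e\<close> together cover \<open>A e\<close>.\<close>
    also have "\<dots> \<le> k * (card (?X \<union> ?Y) + card (?X \<inter> ?Y))"
      using finXY xy by (intro mult_le_mono2 add_mono card_mono) auto
    also have "card (?X \<union> ?Y) + card (?X \<inter> ?Y) = card ?X + card ?Y"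
      using finXY by (rule card_Un_Int[symmetric])
    also have "k * (card ?X + card ?Y) \<le> card I + card J"
      using I(2) J(2) by (simp only: distrib_left add_mono)
    finally show False
      by simp
  qed
qed

text \<open>Discarding candidates while some \<open>A e\<close> has two elements preserves the
  condition and decreases the total size of the sets. Once all are singletons the choice is forced,
  and the condition on each fibre is the capacity bound.\<close>

lemma capacitated_hall:
  fixes A :: "'e \<Rightarrow> 'v set" and k :: nat
  assumes "finite E" "\<And>e. e \<in> E \<Longrightarrow> finite (A e)"
    and "\<And>I. I \<subseteq> E \<Longrightarrow> card I \<le> k * card (\<Union>(A ` I))"
  shows "\<exists>f. (\<forall>e\<in>E. f e \<in> A e) \<and> (\<forall>v. card {e \<in> E. f e = v} \<le> k)"
  using assms(2,3)
proof (induction "\<Sum>e\<in>E. card (A e)" arbitrary: A rule: less_induct)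
  case less
  note fin = less.prems(1) and hall = less.prems(2)
  \<comment> \<open>An empty \<open>A e\<close> would violate the condition for the single index
    \<open>e\<close>.\<close>
  have ne: "A e \<noteq> {}" if "e \<in> E" for e
    using hall[of "{e}"] that by auto
  show ?case
  proof (cases "\<exists>e\<in>E. \<exists>x\<in>A e. \<exists>y\<in>A e. x \<noteq> y")
    case True
    then obtain e x y where e: "e \<in> E" and xy: "x \<in> A e" "y \<in> A e" "x \<noteq> y"
      by blast
    obtain z where z: "z \<in> A e"
      "\<And>I. I \<subseteq> E \<Longrightarrow> card I \<le> k * card (\<Union>((A(e := A e - {z})) ` I))"
      using hall_discard[OF \<open>finite E\<close> fin hall e xy] by blast
    let ?B = "A(e := A e - {z})"
    have finB: "finite (?B d)" if "d \<in> E" for d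
      using fin[OF that] fin[OF e] by simp
    have less_sum: "(\<Sum>e\<in>E. card (?B e)) < (\<Sum>e\<in>E. card (A e))"
    proof (rule sum_strict_mono_ex1)
      show "\<forall>d\<in>E. card (?B d) \<le> card (A d)"
        using fin by (auto intro: card_mono)
      show "\<exists>d\<in>E. card (?B d) < card (A d)"
        using card_Diff1_less[OF fin[OF e] z(1)] e by (intro bexI[of _ e]) simp_all
    qed (fact \<open>finite E\<close>)
    obtain f where "\<forall>d\<in>E. f d \<in> ?B d" "\<forall>v. card {d \<in> E. f d = v} \<le> k"
      using less.hyps[OF less_sum finB z(2)] by blast
    then show ?thesis
      by (intro exI[of _ f]) (auto split: if_splits)
  next
    case False
    define f where "f e = (SOME x. x \<in> A e)" for e
    have f: "f e \<in> A e" if "e \<in> E" for e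
      unfolding f_def using ne[OF that] by (simp add: some_in_eq)
    have "card {e \<in> E. f e = v} \<le> k" for v
    proof -
      have "\<Union>(A ` {e \<in> E. f e = v}) \<subseteq> {v}"
        using False f by blast
      then have le1: "card (\<Union>(A ` {e \<in> E. f e = v})) \<le> 1"
        using card_mono[of "{v}"] by fastforce
      have "card {e \<in> E. f e = v} \<le> k * card (\<Union>(A ` {e \<in> E. f e = v}))"
        by (rule hall) auto
      also have "\<dots> \<le> k * 1"
        using le1 by (rule mult_le_mono2)
      finally show ?thesis
        by simp
    qed
    with f show ?thesis by blast
  qed
qed

section \<open>Upper bound\<close>

text \<open>Each edge chooses its tail among its endpoints, so \<open>id\<close> serves as the set
  family. Hall's condition for an edge set \<open>I\<close> is the density bound for the subgraph
  with edges \<open>I\<close> and vertices \<open>\<Union>I\<close>.\<close>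

lemma bounded_outdegree_tails:
  assumes G: "simple_graph V E" and k: "mad V E / 2 \<le> real k"
  obtains f where "\<And>e. e \<in> E \<Longrightarrow> f e \<in> e" "\<And>v. card {e \<in> E. f e = v} \<le> k"
proof -
  have E: "finite e" "e \<subseteq> V" "card e = 2" if "e \<in> E" for e
    using G that finite_subset unfolding simple_graph_def by auto
  have "card I \<le> k * card (\<Union>(id ` I))" if "I \<subseteq> E" for I
  proof (cases "I = {}")
    case False
    then obtain e where e: "e \<in> I" by blast
    have sub: "\<Union>I \<subseteq> V"
      using that E(2) by blast
    then have fin: "finite (\<Union>I)"
      using G unfolding simple_graph_def by (blast intro: finite_subset)
    have "e \<noteq> {}"
      using E(3) e that by fastforce
    then have ne: "\<Union>I \<noteq> {}"
      using e by blast
    have "subgraph (\<Union>I) I V E"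
      unfolding subgraph_def simple_graph_def using that E fin sub ne by auto
    then have "2 * real (card I) / real (card (\<Union>I)) \<le> mad V E"
      by (rule density_le_mad[OF G])
    then have "real (card I) \<le> mad V E / 2 * real (card (\<Union>I))"
      using fin ne by (simp add: field_simps card_gt_0_iff)
    also have "\<dots> \<le> real k * real (card (\<Union>I))"
      using k by (intro mult_right_mono) auto
    finally show ?thesis
      by (simp flip: of_nat_mult)
  qed auto
  then show ?thesis
    using capacitated_hall[of E id k] simple_graph_finite_edges[OF G] E(1) that by auto
qed

lemma precedes_trans:
  assumes "linear_order_on V r" "precedes r u v" "precedes r v w"
  shows "precedes r u w"
proof -
  have "trans r" "antisym r"
    using assms(1) by (auto simp: linear_order_on_def partial_order_on_def preorder_on_def)
  with assms(2,3) show ?thesis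
    unfolding precedes_def by (metis antisymD transD)
qed

text \<open>Nesting edges have four strictly increasing endpoints and are therefore disjoint. The
  case \<open>e = f\<close> is covered too.\<close>

lemma not_nests_common_vertex:
  assumes "linear_order_on V r" "w \<in> e" "w \<in> f"
  shows "\<not> nests r e f"
proof
  have disj: "{a, d} \<inter> {b, c} = {}"
    if "precedes r a b" "precedes r b c" "precedes r c d" for a b c d
  proof -
    have "precedes r a c" "precedes r b d"
      using that precedes_trans[OF assms(1)] by blast+
    then show ?thesis
      using that by (auto simp: precedes_def)
  qed
  assume "nests r e f"
  then have "e \<inter> f = {}"
    unfolding nests_def using disj by (metis inf_commute)
  then show False
    using assms(2,3) by blast
qed

lemma exists_local_layout:
  assumes G: "simple_graph V E" and k: "mad V E / 2 \<le> real k"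
  shows "\<exists>r P. queue_layout V E r P \<and> local_layout (Suc k) V P"
proof -
  obtain tail where t: "\<And>e. e \<in> E \<Longrightarrow> tail e \<in> e" "\<And>v. card {e \<in> E. tail e = v} \<le> k"
    using bounded_outdegree_tails[OF G k] by blast
  have finE: "finite E"
    by (rule simple_graph_finite_edges[OF G])
  have "\<exists>h. e = {tail e, h}" if "e \<in> E" for e
    using G that t(1)[OF that] unfolding simple_graph_def by (fastforce simp: card_2_iff)
  then obtain head where h: "\<And>e. e \<in> E \<Longrightarrow> e = {tail e, head e}"
    by metis
  have hV: "head e \<in> V" if "e \<in> E" for e
    using G that h[OF that] unfolding simple_graph_def by blast
  \<comment> \<open>\<open>Q v\<close> is the in-star of \<open>v\<close>; empty in-stars are then
    dropped because a partition has no empty block.\<close>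
  define Q where "Q v = {e \<in> E. head e = v}" for v
  define P where "P = Q ` V - {{}}"
  obtain r where r: "well_order_on V r"
    using well_order_on by blast
  then have lin: "linear_order_on V r"
    by (simp add: well_order_on_def)
  have "partition_on E P"
    unfolding partition_on_def P_def Q_def disjoint_def using hV by auto
  moreover have "is_queue r q" if "q \<in> P" for q
    using that not_nests_common_vertex[OF lin] h unfolding is_queue_def P_def Q_def
    by auto (metis insertCI)
  ultimately have "queue_layout V E r P"
    using lin unfolding queue_layout_def by blast
  moreover have "card {q \<in> P. \<exists>e\<in>q. v \<in> e} \<le> Suc k" for v
  proof -
    \<comment> \<open>An edge at \<open>v\<close> lies in the in-star of its head, which is
      \<open>v\<close> or an out-neighbour of \<open>v\<close>.\<close>
    have "{q \<in> P. \<exists>e\<in>q. v \<in> e} \<subseteq> Q ` insert v (head ` {e \<in> E. tail e = v})"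
    proof
      fix q assume "q \<in> {q \<in> P. \<exists>e\<in>q. v \<in> e}"
      then obtain e where e: "q = Q (head e)" "e \<in> E" "v \<in> e"
        unfolding P_def Q_def by auto
      then have "v = head e \<or> v = tail e"
        using h by blast
      with e show "q \<in> Q ` insert v (head ` {e \<in> E. tail e = v})"
        by auto
    qed
    then have "card {q \<in> P. \<exists>e\<in>q. v \<in> e} \<le> card (Q ` insert v (head ` {e \<in> E. tail e = v}))"
      using finE by (intro card_mono) auto
    also have "\<dots> \<le> card (insert v (head ` {e \<in> E. tail e = v}))"
      using finE by (intro card_image_le) auto
    also have "\<dots> \<le> Suc (card (head ` {e \<in> E. tail e = v}))"
      using finE by (simp add: card_insert_if)
    also have "\<dots> \<le> Suc (card {e \<in> E. tail e = v})"
      using finE by (auto intro: card_image_le)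
    finally show ?thesis
      using t(2)[of v] by simp
  qed
  ultimately show ?thesis
    unfolding local_layout_def by blast
qed

section \<open>Lower bound\<close>

lemma card_queue_le:
  assumes lin: "linear_order_on V r" and "finite V"
    and Q: "is_queue r Q" "\<And>e. e \<in> Q \<Longrightarrow> e \<subseteq> V \<and> card e = 2"
  shows "card Q \<le> 2 * card (\<Union>Q)"
proof -
  define W where "W = \<Union>Q"
  have WV: "W \<subseteq> V"
    unfolding W_def using Q(2) by blast
  have finW: "finite W"
    using WV \<open>finite V\<close> by (rule finite_subset)
  have tot: "total_on V r"
    using lin by (simp add: linear_order_on_def)
  have ptot: "precedes r u v \<or> precedes r v u" if "u \<in> W" "v \<in> W" "u \<noteq> v" for u v
    using that tot WV unfolding precedes_def total_on_def by blast
  \<comment> \<open>Ranks are taken within the vertices covered by \<open>Q\<close>, so they run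
    below \<open>card W\<close> rather than \<open>card V\<close>.\<close>
  define rk where "rk v = card {w \<in> W. precedes r w v}" for v
  have rk_less: "rk u < rk v" if "precedes r u v" "u \<in> W" for u v
    unfolding rk_def
  proof (rule psubset_card_mono)
    have "u \<in> {w \<in> W. precedes r w v}" "u \<notin> {w \<in> W. precedes r w u}"
      using that by (auto simp: precedes_def)
    then show "{w \<in> W. precedes r w u} \<subset> {w \<in> W. precedes r w v}"
      using that(1) precedes_trans[OF lin] by blast
  qed (use finW in simp)
  have rk_eq: "u = v" if "rk u = rk v" "u \<in> W" "v \<in> W" for u v
    using that ptot rk_less by (metis less_irrefl)
  have rk_iff: "precedes r u v" if "rk u < rk v" "u \<in> W" "v \<in> W" for u v
    using that ptot rk_less by (metis less_irrefl less_asym)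
  have rk_bound: "rk v < card W" if "v \<in> W" for v
    unfolding rk_def using finW that by (intro psubset_card_mono) (auto simp: precedes_def)
  have edge: "\<exists>u v. e = {u, v} \<and> u \<in> W \<and> v \<in> W \<and> rk u < rk v" if "e \<in> Q" for e
  proof -
    obtain u v where uv: "e = {u, v}" "u \<noteq> v"
      using Q(2)[OF \<open>e \<in> Q\<close>] by (auto simp: card_2_iff)
    have "u \<in> W" "v \<in> W"
      using uv that unfolding W_def by auto
    then show ?thesis
      using uv rk_eq by (metis insert_commute linorder_neqE_nat)
  qed
  \<comment> \<open>With equal rank sums, a smaller left endpoint forces a larger right endpoint,
    hence nesting; equal left endpoints force equal edges.\<close>
  have "inj_on (\<lambda>e. \<Sum>v\<in>e. rk v) Q"
  proof (rule inj_onI)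
    fix e f assume ef: "e \<in> Q" "f \<in> Q" "(\<Sum>v\<in>e. rk v) = (\<Sum>v\<in>f. rk v)"
    obtain u v where e: "e = {u, v}" "u \<in> W" "v \<in> W" "rk u < rk v"
      using edge[OF ef(1)] by blast
    obtain x y where f: "f = {x, y}" "x \<in> W" "y \<in> W" "rk x < rk y"
      using edge[OF ef(2)] by blast
    have "u \<noteq> v" "x \<noteq> y"
      using e(4) f(4) by auto
    then have sum: "rk u + rk v = rk x + rk y"
      using ef(3) e(1) f(1) by simp
    have no: "\<not> nests r e f"
      using Q(1) ef unfolding is_queue_def by blast
    consider "rk u = rk x" | "rk u < rk x" | "rk x < rk u"
      by linarith
    then show "e = f"
    proof cases
      case 1
      then show ?thesis
        using sum e f rk_eq by (metis add_left_cancel)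
    next
      case 2
      then have "precedes r u x" "precedes r x y" "precedes r y v"
        using sum e f by (auto intro!: rk_iff)
      then show ?thesis
        using no e(1) f(1) unfolding nests_def by blast
    next
      case 3
      then have "precedes r x u" "precedes r u v" "precedes r v y"
        using sum e f by (auto intro!: rk_iff)
      then show ?thesis
        using no e(1) f(1) unfolding nests_def by blast
    qed
  qed
  moreover have "(\<lambda>e. \<Sum>v\<in>e. rk v) ` Q \<subseteq> {..<2 * card W}"
  proof (rule image_subsetI)
    fix e assume "e \<in> Q"
    then obtain u v where "e = {u, v}" "u \<in> W" "v \<in> W" "rk u < rk v"
      using edge by blast
    then show "(\<Sum>v\<in>e. rk v) \<in> {..<2 * card W}"
      using rk_bound[of u] rk_bound[of v] by (cases "u = v") auto
  qed
  ultimately have "card Q \<le> card {..<2 * card W}"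
    by (intro card_inj_on_le) auto
  then show ?thesis
    by (simp add: W_def)
qed

text \<open>Each queue restricted to \<open>F\<close> is still a queue, so its size is at most twice
  the number of vertices it covers. Counting vertex-queue incidences from the vertex side gives at
  most \<open>l\<close> per vertex of \<open>W\<close>.\<close>

lemma card_edges_le_local_layout:
  assumes G: "simple_graph V E" and L: "queue_layout V E r P" "local_layout l V P"
    and H: "subgraph W F V E"
  shows "card F \<le> 2 * (l * card W)"
proof -
  have lin: "linear_order_on V r" and part: "partition_on E P"
    and queue: "\<And>q. q \<in> P \<Longrightarrow> is_queue r q"
    using L(1) by (auto simp: queue_layout_def)
  have F: "\<And>e. e \<in> F \<Longrightarrow> e \<subseteq> W \<and> card e = 2" "W \<subseteq> V" "F \<subseteq> E"
    using H by (auto simp: subgraph_def simple_graph_def)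
  have finV: "finite V"
    using G by (simp add: simple_graph_def)
  have finE: "finite E"
    by (rule simple_graph_finite_edges[OF G])
  have finW: "finite W" and finF: "finite F"
    using F(2,3) finV finE by (auto intro: finite_subset)
  have finP: "finite P"
    using finE part by (rule finite_elements)
  have "F = (\<Union>q\<in>P. q \<inter> F)"
    using part F(3) unfolding partition_on_def by blast
  then have "card F \<le> (\<Sum>q\<in>P. card (q \<inter> F))"
    using card_UN_le[OF finP, of "\<lambda>q. q \<inter> F"] by simp
  also have "\<dots> \<le> (\<Sum>q\<in>P. 2 * card {v \<in> W. \<exists>e\<in>q \<inter> F. v \<in> e})"
  proof (rule sum_mono)
    fix q assume q: "q \<in> P"
    have "is_queue r (q \<inter> F)"
      using queue[OF q] unfolding is_queue_def by blast
    then have "card (q \<inter> F) \<le> 2 * card (\<Union>(q \<inter> F))"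
      using F by (intro card_queue_le[OF lin finV]) auto
    also have "\<Union>(q \<inter> F) = {v \<in> W. \<exists>e\<in>q \<inter> F. v \<in> e}"
      using F(1) by blast
    finally show "card (q \<inter> F) \<le> 2 * card {v \<in> W. \<exists>e\<in>q \<inter> F. v \<in> e}" .
  qed
  also have "\<dots> = 2 * (\<Sum>q\<in>P. card {v \<in> W. \<exists>e\<in>q \<inter> F. v \<in> e})"
    by (simp add: sum_distrib_left)
  \<comment> \<open>Double counting of the incidences between \<open>P\<close> and
    \<open>W\<close>.\<close>
  also have "(\<Sum>q\<in>P. card {v \<in> W. \<exists>e\<in>q \<inter> F. v \<in> e})
      = (\<Sum>v\<in>W. card {q \<in> P. \<exists>e\<in>q \<inter> F. v \<in> e})"
    using finP finW by (intro sum_multicount_gen) auto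
  also have "\<dots> \<le> (\<Sum>v\<in>W. l)"
  proof (rule sum_mono)
    fix v assume "v \<in> W"
    have "card {q \<in> P. \<exists>e\<in>q \<inter> F. v \<in> e} \<le> card {q \<in> P. \<exists>e\<in>q. v \<in> e}"
      using finP by (intro card_mono) auto
    also have "\<dots> \<le> l"
      using L(2) \<open>v \<in> W\<close> F(2) unfolding local_layout_def by blast
    finally show "card {q \<in> P. \<exists>e\<in>q \<inter> F. v \<in> e} \<le> l" .
  qed
  finally show ?thesis
    by (simp add: mult.commute)
qed

theorem theorem2:
  fixes V :: "'a set" and E :: "'a set set"
  assumes "simple_graph V E"
  shows "mad V E / 4 \<le> real (local_queue_number V E)
    \<and> real (local_queue_number V E) \<le> mad V E / 2 + 2"
proof
  let ?l = "local_queue_number V E"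
  \<comment> \<open>Rounding up costs at most one; the other one in the additive constant 2 is the
    in-star of the vertex itself.\<close>
  define k where "k = nat \<lceil>mad V E / 2\<rceil>"
  have k: "mad V E / 2 \<le> real k" "real k \<le> mad V E / 2 + 1"
    using mad_nonneg[OF assms] unfolding k_def by linarith+
  note ex = exists_local_layout[OF assms k(1)]
  have "?l \<le> Suc k"
    unfolding local_queue_number_def using ex by (rule Least_le)
  then show "real ?l \<le> mad V E / 2 + 2"
    using k(2) by linarith
  \<comment> \<open>The minimum is attained because the layout of the upper bound exists.\<close>
  have "\<exists>r P. queue_layout V E r P \<and> local_layout ?l V P"
    unfolding local_queue_number_def
    using LeastI[of "\<lambda>l. \<exists>r P. queue_layout V E r P \<and> local_layout l V P", OF ex] .
  then obtain r P where L: "queue_layout V E r P" "local_layout ?l V P"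
    by blast
  have "mad V E \<le> 4 * real ?l"
  proof (rule mad_le[OF assms])
    fix W F assume H: "subgraph W F V E"
    have "real (card F) \<le> real (2 * (?l * card W))"
      using card_edges_le_local_layout[OF assms L H] by (simp only: of_nat_le_iff)
    moreover have "card W > 0"
      using H by (simp add: subgraph_def simple_graph_def card_gt_0_iff)
    ultimately show "2 * real (card F) / real (card W) \<le> 4 * real ?l"
      by (simp add: field_simps)
  qed
  then show "mad V E / 4 \<le> real ?l"
    by simp
qed

end
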